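(* Let $G=(V,E)$ be a directed graph with positive real edge capacities $w$, a designated source vertex $s$ and a designated sink vertex $t$. Let $e=(u,v)$ be a tight edge of $G$. Then any $(s,t)$-cut of least capacity among all $(s,t)$-cuts that separate $u$ and $v$ is a mincut for $e$ (in particular, the least capacity of an $(s,t)$-cut separating $u$ and $v$ equals the capacity of a mincut for $e$).
   Context: An $(s,t)$-cut is a set $C\subset V$ with $s\in C$, $t\notin C$; $\overline{C}=V\setminus C$. Edge $(x,y)$ contributes to $C$ if $x\in C,y\in\overline{C}$; $c(C)$ is the total capacity of contributing edges. $C$ separates $u$ and $v$ if exactly one of $u,v$ lies in $C$. $f^*$ is the minimum capacity of an $(s,t)$-cut. An edge is vital if its removal strictly decreases the minimum $(s,t)$-cut capacity. A mincut for edge $e$ is an $(s,t)$-cut to which $e$ contributes, of minimum capacity among all $(s,t)$-cuts to which $e$ contributes. A vital edge $e$ is tight if there is a maximum $(s,t)$-flow $f$ in $G$ with $f(e)=w(e)$; otherwise it is loose. *)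

theory Defs
  imports Complex_Main "Graph_Theory.Digraph" "Graph_Theory.Digraph_Component"
begin

text \<open>
  Arcs are abstract objects with a tail and a head, so parallel arcs and loops are permitted;
  directed graphs with \<open>E \<subseteq> V \<times> V\<close> are the instances with \<open>tail = fst\<close> and \<open>head = snd\<close>.
\<close>

locale st_graph = fin_digraph G
  for G :: "('a, 'b) pre_digraph" (structure) +
  fixes w :: "'b \<Rightarrow> real" and s t :: 'a
  assumes capacity_pos: "e \<in> arcs G \<Longrightarrow> 0 < w e"
    and source_in_verts: "s \<in> verts G"
    and sink_in_verts: "t \<in> verts G"
    and source_neq_sink: "s \<noteq> t"

definition st_cut :: "('a, 'b) pre_digraph \<Rightarrow> 'a \<Rightarrow> 'a \<Rightarrow> 'a set \<Rightarrow> bool" where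
  "st_cut G s t C \<longleftrightarrow> C \<subseteq> verts G \<and> s \<in> C \<and> t \<notin> C"

definition contributes :: "('a, 'b) pre_digraph \<Rightarrow> 'a set \<Rightarrow> 'b \<Rightarrow> bool" where
  "contributes G C e \<longleftrightarrow> e \<in> arcs G \<and> tail G e \<in> C \<and> head G e \<in> verts G - C"

definition cut_capacity :: "('a, 'b) pre_digraph \<Rightarrow> ('b \<Rightarrow> real) \<Rightarrow> 'a set \<Rightarrow> real" where
  "cut_capacity G w C = (\<Sum>e | contributes G C e. w e)"

definition separates :: "'a set \<Rightarrow> 'a \<Rightarrow> 'a \<Rightarrow> bool" where
  "separates C u v \<longleftrightarrow> (u \<in> C) \<noteq> (v \<in> C)"

definition min_cut_capacity ::
    "('a, 'b) pre_digraph \<Rightarrow> ('b \<Rightarrow> real) \<Rightarrow> 'a \<Rightarrow> 'a \<Rightarrow> real" where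
  "min_cut_capacity G w s t = Min (cut_capacity G w ` {C. st_cut G s t C})"

definition vital_edge ::
    "('a, 'b) pre_digraph \<Rightarrow> ('b \<Rightarrow> real) \<Rightarrow> 'a \<Rightarrow> 'a \<Rightarrow> 'b \<Rightarrow> bool" where
  "vital_edge G w s t e \<longleftrightarrow> e \<in> arcs G \<and>
     min_cut_capacity (pre_digraph.del_arc G e) w s t < min_cut_capacity G w s t"

definition mincut_for_edge ::
    "('a, 'b) pre_digraph \<Rightarrow> ('b \<Rightarrow> real) \<Rightarrow> 'a \<Rightarrow> 'a \<Rightarrow> 'b \<Rightarrow> 'a set \<Rightarrow> bool" where
  "mincut_for_edge G w s t e C \<longleftrightarrow>
     is_arg_min (cut_capacity G w) (\<lambda>C. st_cut G s t C \<and> contributes G C e) C"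

definition least_separating_cut ::
    "('a, 'b) pre_digraph \<Rightarrow> ('b \<Rightarrow> real) \<Rightarrow> 'a \<Rightarrow> 'a \<Rightarrow> 'a \<Rightarrow> 'a \<Rightarrow> 'a set \<Rightarrow> bool" where
  "least_separating_cut G w s t u v C \<longleftrightarrow>
     is_arg_min (cut_capacity G w) (\<lambda>C. st_cut G s t C \<and> separates C u v) C"

definition st_flow ::
    "('a, 'b) pre_digraph \<Rightarrow> ('b \<Rightarrow> real) \<Rightarrow> 'a \<Rightarrow> 'a \<Rightarrow> ('b \<Rightarrow> real) \<Rightarrow> bool" where
  "st_flow G w s t f \<longleftrightarrow>
     (\<forall>e\<in>arcs G. 0 \<le> f e \<and> f e \<le> w e) \<and>
     (\<forall>x\<in>verts G - {s, t}. sum f (in_arcs G x) = sum f (out_arcs G x))"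

definition flow_value :: "('a, 'b) pre_digraph \<Rightarrow> 'a \<Rightarrow> ('b \<Rightarrow> real) \<Rightarrow> real" where
  "flow_value G s f = sum f (out_arcs G s) - sum f (in_arcs G s)"

definition max_st_flow ::
    "('a, 'b) pre_digraph \<Rightarrow> ('b \<Rightarrow> real) \<Rightarrow> 'a \<Rightarrow> 'a \<Rightarrow> ('b \<Rightarrow> real) \<Rightarrow> bool" where
  "max_st_flow G w s t f \<longleftrightarrow> is_arg_max (flow_value G s) (st_flow G w s t) f"

definition tight_edge ::
    "('a, 'b) pre_digraph \<Rightarrow> ('b \<Rightarrow> real) \<Rightarrow> 'a \<Rightarrow> 'a \<Rightarrow> 'b \<Rightarrow> bool" where
  "tight_edge G w s t e \<longleftrightarrow>
     vital_edge G w s t e \<and> (\<exists>f. max_st_flow G w s t f \<and> f e = w e)"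

end

theory Submission
  imports Defs
begin

text \<open>
  Let \<open>f\<close> be a maximum flow saturating \<open>e\<close>. If \<open>v \<in> C\<close> and \<open>u \<notin> C\<close>, then \<open>e\<close> carries \<open>w e\<close> units
  back into \<open>C\<close>, so \<open>C\<close> has capacity at least \<open>f\<^sup>* + w e\<close>. Since \<open>e\<close> is vital, some cut to which
  \<open>e\<close> contributes has capacity less than \<open>f\<^sup>* + w e\<close>. Hence least separating cuts are always
  oriented along \<open>e\<close>. That the value of \<open>f\<close> is \<open>f\<^sup>*\<close> is the max-flow min-cut theorem.
\<close>

section \<open>Net inflow and the value of a flow across a cut\<close>

definition net_inflow :: "('a, 'b) pre_digraph \<Rightarrow> ('b \<Rightarrow> real) \<Rightarrow> 'a \<Rightarrow> real" where
  "net_inflow G f x = sum f (in_arcs G x) - sum f (out_arcs G x)"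

lemma net_inflow_combination:
  "net_inflow G (\<lambda>e. a * f e + b * g e) x = a * net_inflow G f x + b * net_inflow G g x"
  by (simp add: net_inflow_def sum.distrib sum_distrib_left algebra_simps)

context st_graph
begin

lemma net_inflow_single_arc:
  assumes "e \<in> arcs G"
  shows "net_inflow G (\<lambda>a. if a = e then c else 0) x
    = c * (of_bool (x = head G e) - of_bool (x = tail G e))"
proof -
  have "sum (\<lambda>a. if a = e then c else 0) (in_arcs G x) = c * of_bool (x = head G e)"
    using assms by (auto simp: sum.delta in_arcs_def)
  moreover have "sum (\<lambda>a. if a = e then c else 0) (out_arcs G x) = c * of_bool (x = tail G e)"
    using assms by (auto simp: sum.delta out_arcs_def)
  ultimately show ?thesis by (simp add: net_inflow_def algebra_simps)
qed

lemma finite_st_cuts: "finite {C. st_cut G s t C \<and> P C}"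
  by (rule finite_subset[of _ "Pow (verts G)"]) (auto simp: st_cut_def)

lemma finite_contributing: "finite {e. contributes G C e}"
  by (rule finite_subset[of _ "arcs G"]) (auto simp: contributes_def)

lemma min_cut_capacity_le:
  assumes "st_cut G s t C"
  shows "min_cut_capacity G w s t \<le> cut_capacity G w C"
  unfolding min_cut_capacity_def using assms finite_st_cuts[of "\<lambda>_. True"] by (intro Min_le) auto

text \<open>Sum outflow minus inflow over the vertices of \<open>C\<close>. Conservation leaves only
  the term of \<open>s\<close>, as \<open>t\<close> lies outside \<open>C\<close>, and arcs with
  both ends in \<open>C\<close> cancel.\<close>

lemma flow_value_across_cut:
  assumes "st_flow G w s t f" "st_cut G s t C"
  shows "flow_value G s f = sum f {e. contributes G C e}
    - sum f {e \<in> arcs G. tail G e \<notin> C \<and> head G e \<in> C}"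
proof -
  have C: "C \<subseteq> verts G" "s \<in> C" "t \<notin> C" using assms(2) by (auto simp: st_cut_def)
  have finC: "finite C" by (rule finite_subset[OF C(1)]) simp
  let ?both = "{e \<in> arcs G. tail G e \<in> C \<and> head G e \<in> C}"
  let ?back = "{e \<in> arcs G. tail G e \<notin> C \<and> head G e \<in> C}"
  have out: "(\<Sum>x\<in>C. sum f (out_arcs G x)) = sum f {e \<in> arcs G. tail G e \<in> C}"
  proof -
    have "{e \<in> arcs G. tail G e \<in> C} = (\<Union>x\<in>C. out_arcs G x)" by auto
    then show ?thesis using finC by (simp, subst sum.UNION_disjoint) auto
  qed
  have inflow: "(\<Sum>x\<in>C. sum f (in_arcs G x)) = sum f {e \<in> arcs G. head G e \<in> C}"
  proof -
    have "{e \<in> arcs G. head G e \<in> C} = (\<Union>x\<in>C. in_arcs G x)" by auto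
    then show ?thesis using finC by (simp, subst sum.UNION_disjoint) auto
  qed
  have "(\<Sum>x\<in>C. sum f (out_arcs G x) - sum f (in_arcs G x))
      = flow_value G s f + (\<Sum>x\<in>C - {s}. sum f (out_arcs G x) - sum f (in_arcs G x))"
    using finC C(2) by (simp add: sum.remove flow_value_def)
  also have "(\<Sum>x\<in>C - {s}. sum f (out_arcs G x) - sum f (in_arcs G x)) = 0"
  proof (rule sum.neutral, rule ballI)
    fix x assume "x \<in> C - {s}"
    then have "x \<in> verts G - {s, t}" using C by blast
    then show "sum f (out_arcs G x) - sum f (in_arcs G x) = 0"
      using assms(1) by (simp add: st_flow_def)
  qed
  finally have "flow_value G s f
      = sum f {e \<in> arcs G. tail G e \<in> C} - sum f {e \<in> arcs G. head G e \<in> C}"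
    using out inflow by (simp add: sum_subtractf)
  moreover have "sum f {e \<in> arcs G. tail G e \<in> C} = sum f {e. contributes G C e} + sum f ?both"
  proof -
    have "{e \<in> arcs G. tail G e \<in> C} = {e. contributes G C e} \<union> ?both"
      by (auto simp: contributes_def)
    then show ?thesis
      by (simp only:, subst sum.union_disjoint)
        (simp_all add: finite_contributing, auto simp: contributes_def)
  qed
  moreover have "sum f {e \<in> arcs G. head G e \<in> C} = sum f ?back + sum f ?both"
  proof -
    have "{e \<in> arcs G. head G e \<in> C} = ?back \<union> ?both" by auto
    then show ?thesis by (simp, subst sum.union_disjoint) auto
  qed
  ultimately show ?thesis by simp
qed

section \<open>Residual graph reachability, augmentation and max-flow min-cut\<close>

inductive residual_reachable :: "('b \<Rightarrow> real) \<Rightarrow> 'a \<Rightarrow> bool" for f where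
  source: "residual_reachable f s"
| forward: "residual_reachable f (tail G e) \<Longrightarrow> e \<in> arcs G \<Longrightarrow> f e < w e
    \<Longrightarrow> residual_reachable f (head G e)"
| backward: "residual_reachable f (head G e) \<Longrightarrow> e \<in> arcs G \<Longrightarrow> 0 < f e
    \<Longrightarrow> residual_reachable f (tail G e)"

text \<open>Pushing flow from \<open>x\<close> to \<open>y\<close>, phrased by net inflows instead
  of a residual path. The amount \<open>d\<close> is existential because composing two pushes
  shrinks it.\<close>

definition augmentable :: "('b \<Rightarrow> real) \<Rightarrow> 'a \<Rightarrow> 'a \<Rightarrow> bool" where
  "augmentable f x y \<longleftrightarrow> (\<exists>g d. 0 < d \<and> (\<forall>e\<in>arcs G. 0 \<le> g e \<and> g e \<le> w e) \<and>
    (\<forall>z. net_inflow G g z = net_inflow G f z + d * (of_bool (z = y) - of_bool (z = x))))"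

text \<open>
  Convex combinations with the weights \<open>b / (a + b)\<close> and \<open>a / (a + b)\<close> balance the amounts \<open>a\<close>
  and \<open>b\<close> at \<open>y\<close> and respect the capacities, so no simple paths or bottlenecks are needed.
\<close>

lemma augmentable_trans:
  assumes "augmentable f x y" "augmentable f y z"
  shows "augmentable f x z"
proof -
  obtain g a where g: "0 < a" "\<forall>e\<in>arcs G. 0 \<le> g e \<and> g e \<le> w e"
    "\<And>z. net_inflow G g z = net_inflow G f z + a * (of_bool (z = y) - of_bool (z = x))"
    using assms(1) unfolding augmentable_def by blast
  obtain h b where h: "0 < b" "\<forall>e\<in>arcs G. 0 \<le> h e \<and> h e \<le> w e"
    "\<And>x. net_inflow G h x = net_inflow G f x + b * (of_bool (x = z) - of_bool (x = y))"
    using assms(2) unfolding augmentable_def by blast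
  define p where "p = b / (a + b)"
  define q where "q = a / (a + b)"
  have pq: "0 \<le> p" "0 \<le> q" "p + q = 1" "p * a = q * b"
    using g(1) h(1) by (auto simp: p_def q_def add_divide_distrib[symmetric])
  have pa: "0 < p * a" using g(1) h(1) by (simp add: p_def)
  let ?k = "\<lambda>e. p * g e + q * h e"
  have "0 \<le> ?k e \<and> ?k e \<le> w e" if "e \<in> arcs G" for e
    using that g(2) h(2) pq convex_bound_le[of "g e" "w e" "h e" p q] by simp
  moreover have "net_inflow G ?k r
      = net_inflow G f r + (p * a) * (of_bool (r = z) - of_bool (r = x))" for r
  proof -
    have "net_inflow G ?k r = (p + q) * net_inflow G f r
        + (p * a) * (of_bool (r = y) - of_bool (r = x))
        + (q * b) * (of_bool (r = z) - of_bool (r = y))"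
      unfolding net_inflow_combination g(3) h(3) by (simp add: algebra_simps)
    then show ?thesis unfolding pq(3) pq(4)[symmetric] by (simp add: right_diff_distrib)
  qed
  ultimately show ?thesis
    unfolding augmentable_def using pa by (intro exI[of _ ?k] exI[of _ "p * a"]) simp
qed

text \<open>A single residual arc is used up completely: \<open>e\<close> is either filled to
  \<open>w e\<close> or emptied, so \<open>d\<close> is its residual capacity
  \<open>w e - f e\<close> or \<open>f e\<close>.\<close>

lemma augmentable_single_arc:
  assumes f: "\<forall>e\<in>arcs G. 0 \<le> f e \<and> f e \<le> w e" and e: "e \<in> arcs G"
  shows "f e < w e \<Longrightarrow> augmentable f (tail G e) (head G e)"
    and "0 < f e \<Longrightarrow> augmentable f (head G e) (tail G e)"
proof -
  have upd: "net_inflow G (\<lambda>a. f a + (if a = e then c else 0)) z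
      = net_inflow G f z + c * (of_bool (z = head G e) - of_bool (z = tail G e))" for c z
    using net_inflow_combination[of G 1 f 1 "\<lambda>a. if a = e then c else 0" z]
      net_inflow_single_arc[OF e, of c z] by simp
  show "augmentable f (tail G e) (head G e)" if "f e < w e"
    unfolding augmentable_def
  proof (intro exI conjI)
    show "\<forall>a\<in>arcs G. 0 \<le> f a + (if a = e then w e - f e else 0) \<and>
        f a + (if a = e then w e - f e else 0) \<le> w a"
      using f capacity_pos[OF e] by auto
  qed (use that upd in auto)
  show "augmentable f (head G e) (tail G e)" if "0 < f e"
    unfolding augmentable_def
  proof (intro exI conjI)
    show "\<forall>a\<in>arcs G. 0 \<le> f a + (if a = e then - f e else 0) \<and>
        f a + (if a = e then - f e else 0) \<le> w a"
      using f capacity_pos[OF e] by auto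
    show "\<forall>z. net_inflow G (\<lambda>a. f a + (if a = e then - f e else 0)) z
        = net_inflow G f z + f e * (of_bool (z = tail G e) - of_bool (z = head G e))"
      by (simp only: upd) (simp add: algebra_simps)
  qed (use that in auto)
qed

lemma augmentable_if_residual_reachable:
  assumes f: "\<forall>e\<in>arcs G. 0 \<le> f e \<and> f e \<le> w e" and "residual_reachable f x"
  shows "augmentable f s x"
  using assms(2)
proof induction
  case source
  \<comment> \<open>Here \<open>x = s\<close>, so the two indicators cancel: \<open>f\<close> itself
    is a witness, and any positive \<open>d\<close> would do in place of 1.\<close>
  show ?case unfolding augmentable_def using f by (intro exI[of _ f] exI[of _ 1]) simp
next
  case (forward e)
  then show ?case using augmentable_trans augmentable_single_arc(1)[OF f] by blast
next
  case (backward e)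
  then show ?case using augmentable_trans augmentable_single_arc(2)[OF f] by blast
qed

lemma max_flow_not_augmentable:
  assumes "max_st_flow G w s t f"
  shows "\<not> augmentable f s t"
proof
  assume "augmentable f s t"
  then obtain g d where g: "0 < d" "\<forall>e\<in>arcs G. 0 \<le> g e \<and> g e \<le> w e"
    "\<And>z. net_inflow G g z = net_inflow G f z + d * (of_bool (z = t) - of_bool (z = s))"
    unfolding augmentable_def by blast
  have f: "st_flow G w s t f" using assms by (simp add: max_st_flow_def is_arg_max_def)
  have "st_flow G w s t g"
    unfolding st_flow_def
  proof (intro conjI ballI)
    fix x assume "x \<in> verts G - {s, t}"
    then show "sum g (in_arcs G x) = sum g (out_arcs G x)"
      using f g(3)[of x] by (auto simp: st_flow_def net_inflow_def)
  qed (use g(2) in auto)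
  \<comment> \<open>The value is the negated net inflow at \<open>s\<close>, which drops by
    \<open>d\<close> because \<open>s\<close> differs from \<open>t\<close>.\<close>
  moreover have "flow_value G s f < flow_value G s g"
    using g(1) g(3)[of s] source_neq_sink by (simp add: net_inflow_def flow_value_def)
  ultimately show False using assms by (auto simp: max_st_flow_def is_arg_max_def)
qed

text \<open>The residually reachable vertices form a cut \<open>R\<close>. Arcs leaving
  \<open>R\<close> are saturated and arcs entering it are empty, since otherwise their other end
  would be reachable too; so the capacity of \<open>R\<close> is the flow value.\<close>

lemma min_cut_capacity_le_max_flow:
  assumes "max_st_flow G w s t f"
  shows "min_cut_capacity G w s t \<le> flow_value G s f"
proof -
  have f: "st_flow G w s t f" using assms by (simp add: max_st_flow_def is_arg_max_def)
  then have bounds: "\<forall>e\<in>arcs G. 0 \<le> f e \<and> f e \<le> w e" by (simp add: st_flow_def)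
  define R where "R = {x \<in> verts G. residual_reachable f x}"
  \<comment> \<open>If \<open>t\<close> were reachable, \<open>f\<close> could be augmented from
    \<open>s\<close> to \<open>t\<close>, against maximality.\<close>
  have cut: "st_cut G s t R"
    using augmentable_if_residual_reachable[OF bounds, of t] max_flow_not_augmentable[OF assms]
      source_in_verts residual_reachable.source
    by (auto simp: st_cut_def R_def)
  have "sum f {e. contributes G R e} = cut_capacity G w R"
    unfolding cut_capacity_def
  proof (rule sum.cong)
    fix e assume "e \<in> {e. contributes G R e}"
    then have e: "e \<in> arcs G" "residual_reachable f (tail G e)" "\<not> residual_reachable f (head G e)"
      by (auto simp: contributes_def R_def)
    then show "f e = w e" using bounds residual_reachable.forward[of f e] by force
  qed simp
  moreover have "sum f {e \<in> arcs G. tail G e \<notin> R \<and> head G e \<in> R} = 0"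
  proof (rule sum.neutral, safe)
    fix e assume e: "e \<in> arcs G" "tail G e \<notin> R" "head G e \<in> R"
    then show "f e = 0" using bounds residual_reachable.backward[of f e] by (force simp: R_def)
  qed
  ultimately show ?thesis
    using flow_value_across_cut[OF f cut] min_cut_capacity_le[OF cut] by simp
qed

section \<open>Cuts that a tight edge enters and cuts that it leaves\<close>

lemma capacity_of_cut_entered_by_saturated_arc:
  assumes f: "max_st_flow G w s t f" "f e = w e" and e: "e \<in> arcs G"
    and C: "st_cut G s t C" "tail G e \<notin> C" "head G e \<in> C"
  shows "min_cut_capacity G w s t + w e \<le> cut_capacity G w C"
proof -
  have flow: "st_flow G w s t f" using f(1) by (simp add: max_st_flow_def is_arg_max_def)
  then have bounds: "\<forall>e\<in>arcs G. 0 \<le> f e \<and> f e \<le> w e" by (simp add: st_flow_def)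
  have "w e \<le> sum f {e \<in> arcs G. tail G e \<notin> C \<and> head G e \<in> C}"
    unfolding f(2)[symmetric] using e C(2,3) bounds by (intro member_le_sum) auto
  moreover have "sum f {e. contributes G C e} \<le> cut_capacity G w C"
    unfolding cut_capacity_def using bounds by (intro sum_mono) (auto simp: contributes_def)
  ultimately show ?thesis
    using flow_value_across_cut[OF flow C(1)] min_cut_capacity_le_max_flow[OF f(1)] by linarith
qed

text \<open>Take \<open>D\<close> to be a minimum cut after deletion of \<open>e\<close>. If
  \<open>e\<close> did not contribute to \<open>D\<close>, restoring it would leave the capacity
  below the minimum; so it contributes, and restoring it costs exactly \<open>w e\<close>.\<close>

lemma vital_edge_cheap_cut:
  assumes "vital_edge G w s t e"
  obtains D where "st_cut G s t D" "contributes G D e"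
    "cut_capacity G w D < min_cut_capacity G w s t + w e"
proof -
  let ?H = "pre_digraph.del_arc G e"
  have cuts: "{C. st_cut ?H s t C} = {C. st_cut G s t C}" by (simp add: st_cut_def)
  have contr: "{a. contributes ?H D a} = {a. contributes G D a} - {e}" for D
    by (auto simp: contributes_def)
  have "{s} \<in> {C. st_cut G s t C}"
    using source_in_verts source_neq_sink by (auto simp: st_cut_def)
  then have "Min (cut_capacity ?H w ` {C. st_cut ?H s t C})
      \<in> cut_capacity ?H w ` {C. st_cut ?H s t C}"
    unfolding cuts using finite_st_cuts[of "\<lambda>_. True"] by (intro Min_in) auto
  then obtain D where D: "st_cut G s t D" "cut_capacity ?H w D = min_cut_capacity ?H w s t"
    using cuts unfolding min_cut_capacity_def by auto
  have less: "cut_capacity ?H w D < min_cut_capacity G w s t"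
    using D(2) assms by (simp add: vital_edge_def)
  have "contributes G D e"
  proof (rule ccontr)
    assume "\<not> contributes G D e"
    then have "cut_capacity ?H w D = cut_capacity G w D"
      unfolding cut_capacity_def contr by (intro sum.cong) auto
    then show False using less min_cut_capacity_le[OF D(1)] by simp
  qed
  moreover from this have "cut_capacity G w D = cut_capacity ?H w D + w e"
    unfolding cut_capacity_def contr using finite_contributing
    by (simp add: sum.remove)
  ultimately show thesis using that D(1) less by simp
qed

end

theorem theorem2:
  fixes G :: "('a, 'b) pre_digraph" and w :: "'b \<Rightarrow> real" and s t u v :: 'a and e :: 'b
  assumes "st_graph G w s t"
    and "tail G e = u" and "head G e = v"
    and "tight_edge G w s t e"
  shows "(\<forall>C. least_separating_cut G w s t u v C \<longrightarrow> mincut_for_edge G w s t e C) \<and>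
    (\<forall>D. mincut_for_edge G w s t e D \<longrightarrow>
       Min (cut_capacity G w ` {C. st_cut G s t C \<and> separates C u v}) = cut_capacity G w D)"
proof -
  interpret st_graph G w s t by fact
  obtain f where f: "max_st_flow G w s t f" "f e = w e"
    using assms(4) by (auto simp: tight_edge_def)
  have vital: "vital_edge G w s t e" using assms(4) by (simp add: tight_edge_def)
  then have e: "e \<in> arcs G" by (simp add: vital_edge_def)
  obtain D0 where D0: "st_cut G s t D0" "contributes G D0 e"
    "cut_capacity G w D0 < min_cut_capacity G w s t + w e"
    using vital_edge_cheap_cut[OF vital] by blast
  have sep: "separates C u v" if "contributes G C e" for C
    using that assms(2,3) by (auto simp: contributes_def separates_def)
  \<comment> \<open>The strict inequality is what excludes wrongly oriented cuts: the cheap cut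
    \<open>D0\<close> also separates \<open>u\<close> and \<open>v\<close>, so none of them can be
    least.\<close>
  have rev: "cut_capacity G w D0 < cut_capacity G w C"
    if "st_cut G s t C" "separates C u v" "\<not> contributes G C e" for C
  proof -
    have "tail G e \<notin> C" "head G e \<in> C"
      using that(2,3) assms(2,3) e by (auto simp: contributes_def separates_def)
    then show ?thesis
      using capacity_of_cut_entered_by_saturated_arc[OF f e that(1)] D0(3) by simp
  qed
  show ?thesis
  proof (intro conjI allI impI)
    fix C assume C: "least_separating_cut G w s t u v C"
    then have "contributes G C e"
      using rev D0(1,2) sep unfolding least_separating_cut_def is_arg_min_def by blast
    then show "mincut_for_edge G w s t e C"
      using C sep unfolding least_separating_cut_def mincut_for_edge_def is_arg_min_def by blast
  next
    fix D assume "mincut_for_edge G w s t e D"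
    then have D: "st_cut G s t D" "contributes G D e"
      and least: "\<And>C. st_cut G s t C \<Longrightarrow> contributes G C e \<Longrightarrow> cut_capacity G w D \<le> cut_capacity G w C"
      unfolding mincut_for_edge_def is_arg_min_def by force+
    \<comment> \<open>If \<open>e\<close> contributes to \<open>C\<close>, this is minimality of
      \<open>D\<close>; otherwise \<open>D\<close> costs at most \<open>D0\<close>, which is cheaper
      than \<open>C\<close>.\<close>
    have "cut_capacity G w D \<le> cut_capacity G w C" if "st_cut G s t C" "separates C u v" for C
      using that least[of C] rev[of C] least[OF D0(1,2)] by force
    then show "Min (cut_capacity G w ` {C. st_cut G s t C \<and> separates C u v}) = cut_capacity G w D"
      using D sep finite_st_cuts by (intro Min_eqI) auto
  qed
qed

end
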